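(* Let $q,a,b,z$ be complex numbers with $|q|<1$ and $|b/a|<|z|<1$. Then \[ \sum_{n=-\infty}^{\infty}\frac{(a)_n}{(b)_n}z^n = -1 +\frac{(b/a)_\infty(az)_\infty}{(b)_\infty(z)_\infty}\sum_{n=0}^{\infty}\frac{(aqz/b)_n(a)_n}{(q)_n(az)_n}(b/a)^n +\frac{(b/a)_\infty(q/az)_\infty}{(q/a)_\infty(b/az)_\infty}\sum_{n=0}^{\infty}\frac{(q/z)_n(q/b)_n}{(q)_n(q/az)_n}(b/a)^n . \]
   Context: For $|q|<1$ and complex $x$, $(x)_\infty=(x;q)_\infty=\prod_{k=0}^{\infty}(1-xq^k)$, and for any integer $n$ (positive, zero or negative), $(x)_n=(x)_\infty/(xq^n)_\infty$. *)

theory Defs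
  imports "HOL-Analysis.Analysis"
begin

definition qpoch_inf :: "complex \<Rightarrow> complex \<Rightarrow> complex" where
  "qpoch_inf q x = (\<Prod>k. 1 - x * q ^ k)"

text \<open>
  The symbol \<open>(x)\<^sub>n = (x)\<^sub>\<infinity> / (x q\<^sup>n)\<^sub>\<infinity>\<close> for an integer \<open>n\<close>. If \<open>x q\<^sup>n\<close> is a nonpositive power
  of \<open>q\<close>, the denominator vanishes, and the quotient is read after cancelling the common factors
  of the two products; this is the usual value, for instance, of the terminating symbol
  \<open>(q\<^sup>-\<^sup>m)\<^sub>n\<close>. If the cancelled form is itself a pole (\<open>n < 0\<close> and \<open>x = q\<^sup>m\<close> with
  \<open>1 \<le> m \<le> - n\<close>), division by zero gives the value 0, so that \<open>1 / (x)\<^sub>n\<close> is 0 as usual.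
\<close>

definition qpoch :: "complex \<Rightarrow> complex \<Rightarrow> int \<Rightarrow> complex" where
  "qpoch q x n =
     (if qpoch_inf q (x * q powi n) \<noteq> 0 then qpoch_inf q x / qpoch_inf q (x * q powi n)
      else if 0 \<le> n then (\<Prod>k<nat n. 1 - x * q ^ k)
      else 1 / (\<Prod>k=1..nat (- n). 1 - x / q ^ k))"

end

theory Submission
  imports Defs "HOL-Complex_Analysis.Complex_Analysis"
begin

text \<open>
  Split at \<open>n = 0\<close>, the bilateral series consists of the series \<open>\<^sub>2\<phi>\<^sub>1(q, a; b; z)\<close> and
  \<open>\<^sub>2\<phi>\<^sub>1(q, q/b; q/a; b/(az))\<close>, and Heine's second transformation applies to both. To prove the
  latter without the restriction \<open>|b| < 1\<close>, consider \<open>\<Phi>(a, b; c; z) = (c)\<^sub>\<infinity> \<^sub>2\<phi>\<^sub>1(a, b; c; z)\<close>,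
  where reading \<open>(c)\<^sub>\<infinity>/(c)\<^sub>n\<close> as \<open>(cq\<^sup>n)\<^sub>\<infinity>\<close> removes the poles in \<open>c\<close>. If \<open>|b| < 1\<close>, the
  \<open>q\<close>-binomial theorem expands \<open>\<Phi>(a, b; bt; z)\<close> as \<open>(b)\<^sub>\<infinity>\<close> times the double series of
  \<open>(a)\<^sub>n/(q)\<^sub>n z\<^sup>n (t)\<^sub>m/(q)\<^sub>m b\<^sup>m q\<^sup>n\<^sup>m\<close>, which is symmetric under exchanging \<open>(a, z)\<close> with
  \<open>(t, b)\<close>. This symmetry is Heine's first transformation, and using it twice gives the second.
  As \<open>\<Phi>(a, b; bt; z)\<close> is entire in \<open>b\<close>, the identity theorem removes the restriction.
\<close>

no_notation Infinite_Set_Sum.abs_summable_on (infix \<open>abs'_summable'_on\<close> 50)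

subsection \<open>Absolutely convergent series\<close>

lemma abs_summable_on_mult_Times:
  fixes f :: "'a \<Rightarrow> 'c::real_normed_div_algebra" and g :: "'b \<Rightarrow> 'c"
  assumes "f abs_summable_on A" "g abs_summable_on B"
  shows "(\<lambda>(x, y). f x * g y) abs_summable_on A \<times> B"
proof (rule summable_on_SigmaI)
  show "((\<lambda>y. norm (case (x, y) of (x, y) \<Rightarrow> f x * g y)) has_sum
      norm (f x) * (\<Sum>\<^sub>\<infinity>y\<in>B. norm (g y))) B" for x
    using has_sum_cmult_right[OF has_sum_infsum[OF assms(2)], of "norm (f x)"]
    by (simp add: norm_mult)
  show "(\<lambda>x. norm (f x) * (\<Sum>\<^sub>\<infinity>y\<in>B. norm (g y))) summable_on A"
    using assms(1) by (rule summable_on_cmult_left)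
qed simp

lemma suminf_swap:
  fixes f :: "nat \<Rightarrow> nat \<Rightarrow> 'a::banach"
  assumes "(\<lambda>(m, n). f m n) abs_summable_on UNIV \<times> UNIV"
  shows "(\<Sum>m. \<Sum>n. f m n) = (\<Sum>n. \<Sum>m. f m n)"
proof -
  have suminf_eq_infsum: "suminf g = infsum g UNIV" if "g summable_on UNIV" for g :: "nat \<Rightarrow> 'a"
    using that by (intro sums_unique[symmetric] has_sum_imp_sums has_sum_infsum)
  have iterated: "(\<Sum>m. \<Sum>n. g m n) = (\<Sum>\<^sub>\<infinity>m. \<Sum>\<^sub>\<infinity>n. g m n)"
    if "(\<lambda>(m, n). g m n) abs_summable_on UNIV \<times> UNIV" for g :: "nat \<Rightarrow> nat \<Rightarrow> 'a"
  proof -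
    have "g m summable_on UNIV" for m
      using that unfolding Infinite_Sum.abs_summable_on_Sigma_iff
      by (auto intro: abs_summable_summable)
    then show ?thesis
      using summable_on_Sigma_banach[OF abs_summable_summable[OF that]]
      by (simp add: suminf_eq_infsum)
  qed
  have "(\<lambda>(n, m). f m n) abs_summable_on UNIV \<times> UNIV"
    using assms summable_on_swap[of "\<lambda>(m, n). norm (f m n)" UNIV UNIV]
    by (simp add: case_prod_unfold)
  then show ?thesis
    using assms infsum_swap_banach[OF abs_summable_summable[OF assms]] by (simp add: iterated)
qed

lemma holomorphic_on_suminf:
  fixes f :: "nat \<Rightarrow> complex \<Rightarrow> complex"
  assumes "open S" and hol: "\<And>n. f n holomorphic_on S"
    and bound: "\<And>K. compact K \<Longrightarrow> K \<subseteq> S \<Longrightarrow> \<exists>M. summable M \<and> (\<forall>n. \<forall>x\<in>K. norm (f n x) \<le> M n)"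
  shows "(\<lambda>x. \<Sum>n. f n x) holomorphic_on S"
proof (rule holomorphic_uniform_sequence[OF \<open>open S\<close>])
  show "(\<lambda>x. \<Sum>i<n. f i x) holomorphic_on S" for n
    by (intro holomorphic_intros hol)
next
  fix x assume "x \<in> S"
  then obtain d where d: "d > 0" "cball x d \<subseteq> S"
    using \<open>open S\<close> open_contains_cball by blast
  then obtain M where M: "summable M" "\<And>n y. y \<in> cball x d \<Longrightarrow> norm (f n y) \<le> M n"
    using bound[of "cball x d"] by auto
  have "uniform_limit (cball x d) (\<lambda>n y. \<Sum>i<n. f i y) (\<lambda>y. \<Sum>n. f n y) sequentially"
    by (rule Weierstrass_m_test[OF M(2,1)])
  with d show "\<exists>d>0. cball x d \<subseteq> S \<and>
      uniform_limit (cball x d) (\<lambda>n y. \<Sum>i<n. f i y) (\<lambda>y. \<Sum>n. f n y) sequentially"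
    by blast
qed

lemma has_sum_int_from_halves:
  fixes f :: "int \<Rightarrow> 'a :: banach"
  assumes nat: "summable (\<lambda>n. norm (f (int n)))"
    and neg: "summable (\<lambda>n. norm (f (- int n)))"
  shows "(f has_sum ((\<Sum>n. f (int n)) + (\<Sum>n. f (- int n)) - f 0)) UNIV"
proof -
  let ?neg = "\<lambda>n. - int (Suc n)"
  have has_sum_suminf: "(g has_sum suminf g) UNIV" if "summable (\<lambda>n. norm (g n))"
    for g :: "nat \<Rightarrow> 'a"
    using that by (intro norm_summable_imp_has_sum summable_sums[OF summable_norm_cancel])
  have "(f has_sum (\<Sum>n. f (int n))) (range int)"
    using has_sum_suminf[OF nat] by (simp add: has_sum_reindex o_def)
  moreover have "(f has_sum ((\<Sum>n. f (- int n)) - f 0)) (range ?neg)"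
  proof -
    have "(\<Sum>n. f (?neg n)) = (\<Sum>n. f (- int n)) - f 0"
      using suminf_split_head[OF summable_norm_cancel[OF neg]] by simp
    moreover have "summable (\<lambda>n. norm (f (?neg n)))"
      using summable_ignore_initial_segment[OF neg, of 1] by simp
    ultimately show ?thesis
      using has_sum_suminf[of "\<lambda>n. f (?neg n)"]
      by (subst has_sum_reindex) (auto simp: inj_on_def o_def)
  qed
  ultimately have "(f has_sum ((\<Sum>n. f (int n)) + ((\<Sum>n. f (- int n)) - f 0)))
      (range int \<union> range ?neg)"
    by (rule has_sum_Un_disjoint) auto
  moreover have "range int \<union> range ?neg = UNIV"
  proof (intro equalityI subsetI UNIV_I)
    show "k \<in> range int \<union> range ?neg" for k
      by (cases k rule: int_cases) blast+
  qed
  ultimately show ?thesis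
    by (simp add: add_diff_eq)
qed

subsection \<open>The \<open>q\<close>-Pochhammer symbol\<close>

definition qpoch_fin :: "'a::comm_ring_1 \<Rightarrow> 'a \<Rightarrow> nat \<Rightarrow> 'a" where
  "qpoch_fin q x n = (\<Prod>k<n. 1 - x * q ^ k)"

lemma qpoch_fin_0 [simp]: "qpoch_fin q x 0 = 1"
  by (simp add: qpoch_fin_def)

lemma qpoch_fin_Suc: "qpoch_fin q x (Suc n) = qpoch_fin q x n * (1 - x * q ^ n)"
  by (simp add: qpoch_fin_def)

lemma qpoch_fin_Suc_left: "qpoch_fin q x (Suc n) = (1 - x) * qpoch_fin q (x * q) n"
  by (simp add: qpoch_fin_def prod.lessThan_Suc_shift mult.assoc del: prod.lessThan_Suc)

lemma prod_one_minus_divide_power_eq_qpoch_fin: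
  fixes q :: "'a::field"
  assumes "q \<noteq> 0"
  shows "(\<Prod>k=1..n. 1 - x / q ^ k) = qpoch_fin q (x / q ^ n) n"
proof (induction n)
  case (Suc n)
  have "x / q ^ Suc n * q = x / q ^ n"
    using assms by simp
  with Suc show ?case
    by (simp add: qpoch_fin_Suc_left mult.commute)
qed simp

lemma qpoch_fin_reverse:
  fixes q :: "'a::field"
  assumes "q \<noteq> 0" "x \<noteq> 0"
  shows "qpoch_fin q (x / q ^ n) n = (- x / q) ^ n / q ^ (n choose 2) * qpoch_fin q (q / x) n"
proof (induction n)
  case (Suc n)
  have shift: "x / q ^ Suc n * q = x / q ^ n"
    using assms by simp
  have factor: "1 - x / q ^ Suc n = (- x / q) / q ^ n * (1 - q / x * q ^ n)"
    using assms by (simp add: field_simps)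
  have "Suc n choose 2 = n + (n choose 2)"
    by (simp add: numeral_2_eq_2)
  then show ?case
    unfolding qpoch_fin_Suc_left[of q "x / q ^ Suc n"] shift Suc factor
    by (simp add: qpoch_fin_Suc power_add mult_ac)
qed (simp add: numeral_2_eq_2)

locale q_base =
  fixes q :: complex
  assumes norm_q: "norm q < 1"
begin

lemma norm_mult_q_power_le: "norm (x * q ^ n) \<le> norm x"
  using norm_q by (simp add: norm_mult norm_power mult_left_le power_le_one)

lemma convergent_prod_qpoch: "convergent_prod (\<lambda>k. 1 - x * q ^ k)"
proof -
  have "summable (\<lambda>k. norm (1 - x * q ^ k - 1))"
    using norm_q by (simp add: norm_mult norm_power)
  then show ?thesis
    by (intro abs_convergent_prod_imp_convergent_prod summable_imp_abs_convergent_prod)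
qed

lemma has_prod_qpoch_inf: "(\<lambda>k. 1 - x * q ^ k) has_prod qpoch_inf q x"
  using convergent_prod_qpoch unfolding qpoch_inf_def by (rule convergent_prod_has_prod)

lemma qpoch_fin_tendsto: "qpoch_fin q x \<longlonglongrightarrow> qpoch_inf q x"
  using has_prod_imp_tendsto'[OF has_prod_qpoch_inf] by (simp add: qpoch_fin_def[abs_def])

lemma qpoch_inf_eq_0_iff: "qpoch_inf q x = 0 \<longleftrightarrow> (\<exists>k. x * q ^ k = 1)"
  using has_prod_eq_0_iff[OF has_prod_qpoch_inf] by (auto simp: image_iff)

lemma qpoch_inf_split: "qpoch_inf q x = qpoch_fin q x n * qpoch_inf q (x * q ^ n)"
  using has_prod_unique2[OF has_prod_qpoch_inf
      has_prod_ignore_initial_segment'[OF convergent_prod_qpoch, of x n]]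
  by (simp add: qpoch_fin_def qpoch_inf_def power_add mult_ac)

lemma qpoch_inf_nonzero:
  assumes "norm x < 1"
  shows "qpoch_inf q x \<noteq> 0"
proof -
  have "norm (x * q ^ k) < 1" for k
    using norm_mult_q_power_le assms by (rule le_less_trans)
  then show ?thesis
    by (metis norm_one less_irrefl qpoch_inf_eq_0_iff)
qed

lemma qpoch_fin_nonzero: "qpoch_inf q x \<noteq> 0 \<Longrightarrow> qpoch_fin q x n \<noteq> 0"
  using qpoch_inf_split[of x n] by auto

lemma norm_qpoch_fin_le: "norm (qpoch_fin q x n) \<le> exp (norm x / (1 - norm q))"
proof -
  have "norm (qpoch_fin q x n) = (\<Prod>k<n. norm (1 - x * q ^ k))"
    by (simp add: qpoch_fin_def prod_norm)
  also have "\<dots> \<le> (\<Prod>k<n. 1 + norm x * norm q ^ k)"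
    by (intro prod_mono conjI norm_ge_zero norm_triangle_ineq4[THEN order_trans])
      (auto simp: norm_mult norm_power)
  also have "\<dots> \<le> exp (\<Sum>k<n. norm x * norm q ^ k)"
    by (intro prod_le_exp_sum) simp
  also have "(\<Sum>k<n. norm x * norm q ^ k) \<le> (\<Sum>k. norm x * norm q ^ k)"
    using norm_q by (intro sum_le_suminf) auto
  also have "\<dots> = norm x / (1 - norm q)"
    using norm_q by (simp add: suminf_mult suminf_geometric)
  finally show ?thesis by simp
qed

lemma norm_qpoch_inf_le: "norm (qpoch_inf q x) \<le> exp (norm x / (1 - norm q))"
  using tendsto_norm[OF qpoch_fin_tendsto[of x]]
  by (rule LIMSEQ_le_const2) (use norm_qpoch_fin_le in blast)

lemma holomorphic_on_qpoch_inf: "qpoch_inf q holomorphic_on UNIV"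
proof (rule holomorphic_uniform_sequence[OF open_UNIV])
  show "(\<lambda>x. qpoch_fin q x n) holomorphic_on UNIV" for n
    unfolding qpoch_fin_def by (intro holomorphic_intros)
next
  fix x :: complex
  have "uniformly_convergent_on (cball x 1) (\<lambda>n y. \<Sum>k<n. norm (1 - y * q ^ k - 1))"
  proof (rule Weierstrass_m_test')
    show "norm (norm (1 - y * q ^ k - 1)) \<le> (norm x + 1) * norm q ^ k" if "y \<in> cball x 1" for k y
      using that norm_triangle_sub[of y x]
      by (auto simp: norm_mult norm_power dist_norm norm_minus_commute intro!: mult_right_mono)
    show "summable (\<lambda>k. (norm x + 1) * norm q ^ k)"
      using norm_q by simp
  qed
  then have "uniformly_convergent_on (cball x 1) (\<lambda>n y. qpoch_fin q y n)"
    unfolding qpoch_fin_def by (intro uniformly_convergent_on_prod' continuous_intros) auto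
  then have "uniform_limit (cball x 1) (\<lambda>n y. qpoch_fin q y n) (qpoch_inf q) sequentially"
    using qpoch_fin_tendsto[THEN limI] by (simp add: uniformly_convergent_uniform_limit_iff)
  then show "\<exists>d>0. cball x d \<subseteq> UNIV \<and>
      uniform_limit (cball x d) (\<lambda>n y. qpoch_fin q y n) (qpoch_inf q) sequentially"
    by (intro exI[of _ 1]) simp
qed

lemma qpoch_nat: "qpoch q x (int n) = qpoch_fin q x n"
  using qpoch_inf_split[of x n] by (auto simp: qpoch_def qpoch_fin_def)

lemma qpoch_neg:
  assumes "q \<noteq> 0" "x \<noteq> 0"
  shows "qpoch q x (- int n) = (- q / x) ^ n * q ^ (n choose 2) / qpoch_fin q (q / x) n"
proof -
  have "qpoch_inf q (x / q ^ n) = qpoch_fin q (x / q ^ n) n * qpoch_inf q x"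
    using qpoch_inf_split[of "x / q ^ n" n] assms by simp
  moreover have "x * q powi (- int n) = x / q ^ n"
    by (simp add: power_int_minus divide_inverse)
  ultimately have "qpoch q x (- int n) = inverse (qpoch_fin q (x / q ^ n) n)"
    using prod_one_minus_divide_power_eq_qpoch_fin[OF assms(1), of x n]
    by (auto simp: qpoch_def divide_inverse)
  also have "\<dots> = inverse ((- x / q) ^ n) * q ^ (n choose 2) / qpoch_fin q (q / x) n"
    unfolding qpoch_fin_reverse[OF assms] by (simp add: divide_inverse)
  also have "inverse ((- x / q) ^ n) = (- q / x) ^ n"
    by (simp flip: power_inverse)
  finally show ?thesis .
qed

lemma qpoch_neg_ratio:
  assumes "q \<noteq> 0" "a \<noteq> 0" "b \<noteq> 0"
  shows "qpoch q a (- int n) / qpoch q b (- int n) =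
    (b / a) ^ n * (qpoch_fin q (q / b) n / qpoch_fin q (q / a) n)"
proof -
  define u where "u = (- q / b) ^ n * q ^ (n choose 2)"
  have "(- q / a) ^ n = (b / a) ^ n * (- q / b) ^ n"
    unfolding power_mult_distrib[symmetric] using assms by simp
  then have "qpoch q a (- int n) / qpoch q b (- int n) =
      (b / a) ^ n * u / qpoch_fin q (q / a) n / (u / qpoch_fin q (q / b) n)"
    unfolding qpoch_neg[OF assms(1,2)] qpoch_neg[OF assms(1,3)] by (simp only: u_def mult.assoc)
  moreover have "u \<noteq> 0"
    using assms by (simp add: u_def)
  ultimately show ?thesis
    by simp
qed

end

subsection \<open>The \<open>q\<close>-binomial theorem\<close>

definition qbinomial_coeff :: "'a::field \<Rightarrow> 'a \<Rightarrow> nat \<Rightarrow> 'a" where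
  "qbinomial_coeff q a n = qpoch_fin q a n / qpoch_fin q q n"

context q_base
begin

lemma qbinomial_coeff_bounded:
  obtains C where "\<And>n. norm (qbinomial_coeff q a n) \<le> C"
proof -
  have "qbinomial_coeff q a \<longlonglongrightarrow> qpoch_inf q a / qpoch_inf q q"
    unfolding qbinomial_coeff_def
    by (intro tendsto_divide qpoch_fin_tendsto qpoch_inf_nonzero norm_q)
  then have "Bseq (qbinomial_coeff q a)"
    by (intro convergent_imp_Bseq convergentI)
  then show ?thesis
    by (elim BseqE) (rule that, blast)
qed

lemma qbinomial_coeff_Suc:
  "(1 - q ^ Suc n) * qbinomial_coeff q a (Suc n) = (1 - a * q ^ n) * qbinomial_coeff q a n"
  using qpoch_fin_nonzero[OF qpoch_inf_nonzero[OF norm_q], of "Suc n"]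
  by (simp add: qbinomial_coeff_def qpoch_fin_Suc)

lemma summable_norm_qbinomial_series:
  assumes "norm z < 1"
  shows "summable (\<lambda>n. norm (qbinomial_coeff q a n * z ^ n))"
proof -
  obtain C where C: "\<And>n. norm (qbinomial_coeff q a n) \<le> C"
    using qbinomial_coeff_bounded[of a] by blast
  show ?thesis
  proof (rule summable_comparison_test')
    show "summable (\<lambda>n. C * norm z ^ n)"
      using assms by simp
    show "norm (norm (qbinomial_coeff q a n * z ^ n)) \<le> C * norm z ^ n" for n
      using C by (simp add: norm_mult norm_power mult_right_mono)
  qed
qed

lemma qbinomial_functional_equation:
  assumes "norm z < 1"
  shows "(1 - z) * (\<Sum>n. qbinomial_coeff q a n * z ^ n) =
    (1 - a * z) * (\<Sum>n. qbinomial_coeff q a n * (z * q) ^ n)"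
proof -
  define c where "c = qbinomial_coeff q a"
  have norm_zq: "norm (z * q) < 1"
    using norm_mult_q_power_le[of z 1] assms by simp
  have sums_z: "(\<lambda>n. c n * z ^ n) sums (\<Sum>n. c n * z ^ n)"
    and sums_zq: "(\<lambda>n. c n * (z * q) ^ n) sums (\<Sum>n. c n * (z * q) ^ n)"
    unfolding c_def
    by (intro summable_sums summable_norm_cancel[OF summable_norm_qbinomial_series] assms norm_zq)+
  have shifted: "(1 - q ^ Suc n) * c (Suc n) * z ^ Suc n =
      z * (c n * z ^ n) - a * z * (c n * (z * q) ^ n)" for n
    unfolding c_def qbinomial_coeff_Suc by (simp add: algebra_simps power_mult_distrib)
  have "(\<lambda>n. (1 - q ^ n) * c n * z ^ n) sums
      ((\<Sum>n. c n * z ^ n) - (\<Sum>n. c n * (z * q) ^ n))"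
    using sums_diff[OF sums_z sums_zq] by (simp add: algebra_simps power_mult_distrib)
  moreover have "(\<lambda>n. (1 - q ^ n) * c n * z ^ n) sums
      (z * (\<Sum>n. c n * z ^ n) - a * z * (\<Sum>n. c n * (z * q) ^ n))"
    using sums_Suc[of "\<lambda>n. (1 - q ^ n) * c n * z ^ n",
        unfolded shifted, OF sums_diff[OF sums_mult[OF sums_z] sums_mult[OF sums_zq]]]
    by simp
  ultimately have "(\<Sum>n. c n * z ^ n) - (\<Sum>n. c n * (z * q) ^ n) =
      z * (\<Sum>n. c n * z ^ n) - a * z * (\<Sum>n. c n * (z * q) ^ n)"
    by (rule sums_unique2)
  then show ?thesis
    by (simp add: c_def algebra_simps)
qed

lemma qbinomial_functional_equation_iterated:
  assumes "norm z < 1"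
  shows "qpoch_fin q z N * (\<Sum>n. qbinomial_coeff q a n * z ^ n) =
    qpoch_fin q (a * z) N * (\<Sum>n. qbinomial_coeff q a n * (z * q ^ N) ^ n)"
proof (induction N)
  case (Suc N)
  define f where "f x = (\<Sum>n. qbinomial_coeff q a n * x ^ n)" for x
  have "norm (z * q ^ N) < 1"
    using norm_mult_q_power_le assms by (rule le_less_trans)
  from qbinomial_functional_equation[OF this, of a]
  have recurrence: "(1 - z * q ^ N) * f (z * q ^ N) = (1 - a * z * q ^ N) * f (z * q ^ Suc N)"
    by (simp add: f_def mult_ac)
  have "qpoch_fin q z (Suc N) * f z = (1 - z * q ^ N) * (qpoch_fin q z N * f z)"
    by (simp add: qpoch_fin_Suc)
  also have "\<dots> = qpoch_fin q (a * z) N * ((1 - z * q ^ N) * f (z * q ^ N))"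
    using Suc by (simp add: f_def)
  also have "\<dots> = qpoch_fin q (a * z) (Suc N) * f (z * q ^ Suc N)"
    by (simp add: recurrence qpoch_fin_Suc)
  finally show ?case
    by (simp only: f_def)
qed simp

theorem qbinomial_theorem:
  assumes "norm z < 1"
  shows "qpoch_inf q z * (\<Sum>n. qbinomial_coeff q a n * z ^ n) = qpoch_inf q (a * z)"
proof -
  define f where "f x = (\<Sum>n. qbinomial_coeff q a n * x ^ n)" for x
  have iterated: "qpoch_fin q z N * f z = qpoch_fin q (a * z) N * f (z * q ^ N)" for N
    unfolding f_def by (rule qbinomial_functional_equation_iterated[OF assms])
  have "isCont f 0"
    unfolding f_def
    using summable_norm_cancel[OF summable_norm_qbinomial_series[of "1/2"]]
    by (intro isCont_powser[where K = "1/2"]) auto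
  moreover have "(\<lambda>N. z * q ^ N) \<longlonglongrightarrow> 0"
    using norm_q by (intro tendsto_mult_right_zero LIMSEQ_power_zero) auto
  ultimately have "(\<lambda>N. f (z * q ^ N)) \<longlonglongrightarrow> f 0"
    by (rule isCont_tendsto_compose)
  moreover have "f 0 = 1"
    unfolding f_def powser_zero by (simp add: qbinomial_coeff_def)
  ultimately have "(\<lambda>N. qpoch_fin q (a * z) N * f (z * q ^ N)) \<longlonglongrightarrow> qpoch_inf q (a * z) * 1"
    by (intro tendsto_mult qpoch_fin_tendsto) simp
  moreover have "(\<lambda>N. qpoch_fin q z N * f z) \<longlonglongrightarrow> qpoch_inf q z * f z"
    by (intro tendsto_intros qpoch_fin_tendsto)
  ultimately have "qpoch_inf q z * f z = qpoch_inf q (a * z) * 1"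
    unfolding iterated by (rule LIMSEQ_unique[rotated])
  then show ?thesis
    by (simp add: f_def)
qed

end

subsection \<open>Heine's transformations\<close>

definition phi21_term :: "'a::field \<Rightarrow> 'a \<Rightarrow> 'a \<Rightarrow> 'a \<Rightarrow> 'a \<Rightarrow> nat \<Rightarrow> 'a" where
  "phi21_term q a b c z n =
     qpoch_fin q a n * qpoch_fin q b n / (qpoch_fin q q n * qpoch_fin q c n) * z ^ n"

definition phi21 :: "complex \<Rightarrow> complex \<Rightarrow> complex \<Rightarrow> complex \<Rightarrow> complex \<Rightarrow> complex" where
  "phi21 q a b c z = (\<Sum>n. phi21_term q a b c z n)"

definition phi21_reg_term ::
    "complex \<Rightarrow> complex \<Rightarrow> complex \<Rightarrow> complex \<Rightarrow> complex \<Rightarrow> nat \<Rightarrow> complex" where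
  "phi21_reg_term q a b c z n =
     qbinomial_coeff q a n * qpoch_fin q b n * qpoch_inf q (c * q ^ n) * z ^ n"

definition phi21_reg :: "complex \<Rightarrow> complex \<Rightarrow> complex \<Rightarrow> complex \<Rightarrow> complex \<Rightarrow> complex" where
  "phi21_reg q a b c z = (\<Sum>n. phi21_reg_term q a b c z n)"

lemma phi21_reg_commute: "phi21_reg q a b c z = phi21_reg q b a c z"
  by (simp add: phi21_reg_def phi21_reg_term_def qbinomial_coeff_def mult_ac)

definition heine_kernel ::
    "'a::field \<Rightarrow> 'a \<Rightarrow> 'a \<Rightarrow> 'a \<Rightarrow> 'a \<Rightarrow> nat \<Rightarrow> nat \<Rightarrow> 'a" where
  "heine_kernel q a z t b n m =
     (qbinomial_coeff q a n * z ^ n) * (qbinomial_coeff q t m * b ^ m) * q ^ (n * m)"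

lemma heine_kernel_commute: "heine_kernel q a z t b n m = heine_kernel q t b a z m n"
  by (simp add: heine_kernel_def mult_ac)

context q_base
begin

lemma norm_phi21_reg_term_le:
  assumes "norm (qbinomial_coeff q a n) \<le> C" "norm b \<le> r" "norm c \<le> s"
  shows "norm (phi21_reg_term q a b c z n) \<le>
    C * exp (r / (1 - norm q)) * exp (s / (1 - norm q)) * norm z ^ n"
proof -
  have exp_le: "exp (norm x / (1 - norm q)) \<le> exp (r / (1 - norm q))" if "norm x \<le> r"
    for x :: complex and r
    using that norm_q by (simp add: divide_right_mono)
  have "norm (qpoch_fin q b n) \<le> exp (r / (1 - norm q))"
    using norm_qpoch_fin_le exp_le[OF assms(2)] by (rule order_trans)
  moreover have "norm (qpoch_inf q (c * q ^ n)) \<le> exp (s / (1 - norm q))"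
    using norm_mult_q_power_le[of c n] assms(3)
    by (intro order_trans[OF norm_qpoch_inf_le] exp_le) linarith
  ultimately show ?thesis
    using assms(1) order_trans[OF norm_ge_zero assms(1)]
    unfolding phi21_reg_term_def norm_mult norm_power
    by (intro mult_right_mono mult_mono) auto
qed

lemma summable_norm_phi21_reg_term:
  assumes "norm z < 1"
  shows "summable (\<lambda>n. norm (phi21_reg_term q a b c z n))"
proof -
  obtain C where C: "\<And>n. norm (qbinomial_coeff q a n) \<le> C"
    using qbinomial_coeff_bounded[of a] by blast
  let ?D = "C * exp (norm b / (1 - norm q)) * exp (norm c / (1 - norm q))"
  show ?thesis
  proof (rule summable_comparison_test')
    show "summable (\<lambda>n. ?D * norm z ^ n)"
      using assms by (intro summable_mult summable_geometric) simp
    show "norm (norm (phi21_reg_term q a b c z n)) \<le> ?D * norm z ^ n" for n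
      using norm_phi21_reg_term_le[OF C order.refl order.refl] by simp
  qed
qed

lemma holomorphic_on_phi21_reg:
  assumes "norm z < 1"
  shows "(\<lambda>b. phi21_reg q a b (b * t) z) holomorphic_on UNIV"
  unfolding phi21_reg_def
proof (rule holomorphic_on_suminf[OF open_UNIV])
  have "(\<lambda>b. qpoch_inf q (b * t * q ^ n)) holomorphic_on UNIV" for n
    using holomorphic_on_compose[of "\<lambda>b. b * t * q ^ n" UNIV,
        OF _ holomorphic_on_subset[OF holomorphic_on_qpoch_inf]]
    by (simp add: o_def holomorphic_intros)
  then show "(\<lambda>b. phi21_reg_term q a b (b * t) z n) holomorphic_on UNIV" for n
    unfolding phi21_reg_term_def qpoch_fin_def by (intro holomorphic_intros)
next
  fix K :: "complex set" assume "compact K"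
  then obtain r where r: "\<And>b. b \<in> K \<Longrightarrow> norm b \<le> r"
    using compact_imp_bounded bounded_iff by metis
  obtain C where C: "\<And>n. norm (qbinomial_coeff q a n) \<le> C"
    using qbinomial_coeff_bounded[of a] by blast
  define M where "M n = C * exp (r / (1 - norm q)) * exp (r * norm t / (1 - norm q)) * norm z ^ n"
    for n
  have "summable M"
    unfolding M_def using assms by simp
  moreover have "norm (phi21_reg_term q a b (b * t) z n) \<le> M n" if "b \<in> K" for b n
    unfolding M_def using r[OF that]
    by (intro norm_phi21_reg_term_le C) (auto simp: norm_mult intro: mult_right_mono)
  ultimately show "\<exists>M. summable M \<and>
      (\<forall>n. \<forall>b\<in>K. norm (phi21_reg_term q a b (b * t) z n) \<le> M n)"
    by blast
qed

lemma heine_kernel_abs_summable_on: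
  assumes "norm z < 1" "norm b < 1"
  shows "(\<lambda>(n, m). heine_kernel q a z t b n m) abs_summable_on UNIV \<times> UNIV"
proof (rule Infinite_Sum.abs_summable_on_comparison_test)
  let ?g = "\<lambda>(n, m). (qbinomial_coeff q a n * z ^ n) * (qbinomial_coeff q t m * b ^ m)"
  have "(\<lambda>n. qbinomial_coeff q c n * x ^ n) abs_summable_on UNIV" if "norm x < 1" for c x
    using summable_norm_qbinomial_series[OF that] by (intro norm_summable_imp_summable_on) simp
  with assms show "?g abs_summable_on UNIV \<times> UNIV"
    using abs_summable_on_mult_Times[of "\<lambda>n. qbinomial_coeff q a n * z ^ n" UNIV
        "\<lambda>m. qbinomial_coeff q t m * b ^ m" UNIV] by blast
  show "norm (case p of (n, m) \<Rightarrow> heine_kernel q a z t b n m) \<le> norm (?g p)" for p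
    unfolding heine_kernel_def by (cases p) (simp only: norm_mult_q_power_le prod.case)
qed

lemma suminf_heine_kernel:
  assumes "norm b < 1"
  shows "(\<Sum>m. heine_kernel q a z t b n m) = phi21_reg_term q a b (b * t) z n / qpoch_inf q b"
proof -
  have norm_bq: "norm (b * q ^ n) < 1"
    using norm_mult_q_power_le assms by (rule le_less_trans)
  have "(\<Sum>m. heine_kernel q a z t b n m) =
      (\<Sum>m. qbinomial_coeff q a n * z ^ n * (qbinomial_coeff q t m * (b * q ^ n) ^ m))"
    by (simp only: heine_kernel_def power_mult_distrib power_mult mult.assoc)
  also have "\<dots> = qbinomial_coeff q a n * z ^ n * (\<Sum>m. qbinomial_coeff q t m * (b * q ^ n) ^ m)"
    by (intro suminf_mult summable_norm_cancel[OF summable_norm_qbinomial_series] norm_bq)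
  also have "(\<Sum>m. qbinomial_coeff q t m * (b * q ^ n) ^ m) =
      qpoch_inf q (b * t * q ^ n) / qpoch_inf q (b * q ^ n)"
    using qbinomial_theorem[OF norm_bq, of t]
    by (simp only: nonzero_eq_divide_eq[OF qpoch_inf_nonzero[OF norm_bq]] mult_ac)
  also have "\<dots> = qpoch_fin q b n * qpoch_inf q (b * t * q ^ n) / qpoch_inf q b"
    using qpoch_inf_split[of b n] qpoch_inf_nonzero[OF assms] by simp
  finally show ?thesis
    by (simp add: phi21_reg_term_def)
qed

lemma phi21_reg_eq_heine_kernel_sum:
  assumes "norm z < 1" "norm b < 1"
  shows "phi21_reg q a b (b * t) z = qpoch_inf q b * (\<Sum>n. \<Sum>m. heine_kernel q a z t b n m)"
proof -
  have "(\<Sum>n. \<Sum>m. heine_kernel q a z t b n m) = phi21_reg q a b (b * t) z / qpoch_inf q b"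
    unfolding suminf_heine_kernel[OF assms(2)] phi21_reg_def
    by (intro suminf_divide summable_norm_cancel[OF summable_norm_phi21_reg_term] assms)
  then show ?thesis
    using qpoch_inf_nonzero[OF assms(2)] by simp
qed

lemma phi21_reg_Heine_first:
  assumes "norm z < 1" "norm b < 1"
  shows "qpoch_inf q z * phi21_reg q a b (b * t) z = qpoch_inf q b * phi21_reg q t z (z * a) b"
proof -
  have "(\<Sum>n. \<Sum>m. heine_kernel q a z t b n m) = (\<Sum>m. \<Sum>n. heine_kernel q a z t b n m)"
    using assms by (intro suminf_swap heine_kernel_abs_summable_on)
  also have "\<dots> = (\<Sum>m. \<Sum>n. heine_kernel q t b a z m n)"
    by (simp only: heine_kernel_commute[of q a z t b])
  finally show ?thesis
    using assms by (simp add: phi21_reg_eq_heine_kernel_sum)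
qed

theorem phi21_reg_Heine_second:
  assumes z: "norm z < 1" and t: "norm t < 1" and w: "w * t = a * z"
  shows "qpoch_inf q z * phi21_reg q a b (b * t) z = qpoch_inf q t * phi21_reg q w b (b * z) t"
proof (rule analytic_continuation_open[where s = "ball 0 1" and s' = UNIV and z = b])
  fix b :: complex assume "b \<in> ball 0 1"
  then have b: "norm b < 1" by simp
  have "qpoch_inf q z * phi21_reg q a b (b * t) z = qpoch_inf q b * phi21_reg q t z (z * a) b"
    by (rule phi21_reg_Heine_first[OF z b])
  also have "\<dots> = qpoch_inf q b * phi21_reg q z t (t * w) b"
    using w by (simp add: phi21_reg_commute[of q t z] mult.commute)
  also have "\<dots> = qpoch_inf q t * phi21_reg q w b (b * z) t"
    by (rule phi21_reg_Heine_first[OF t b, symmetric])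
  finally show "qpoch_inf q z * phi21_reg q a b (b * t) z =
      qpoch_inf q t * phi21_reg q w b (b * z) t" .
qed (use z t in \<open>auto intro!: holomorphic_intros holomorphic_on_phi21_reg\<close>)

lemma phi21_reg_term_eq:
  assumes "qpoch_inf q c \<noteq> 0"
  shows "phi21_reg_term q a b c z n = qpoch_inf q c * phi21_term q a b c z n"
  using qpoch_inf_split[of c n] qpoch_fin_nonzero[OF assms, of n]
  by (simp add: phi21_reg_term_def phi21_term_def qbinomial_coeff_def)

lemma summable_norm_phi21_term:
  assumes "norm z < 1" "qpoch_inf q c \<noteq> 0"
  shows "summable (\<lambda>n. norm (phi21_term q a b c z n))"
  using summable_norm_phi21_reg_term[OF assms(1), of a b c] assms(2)
  by (simp add: phi21_reg_term_eq norm_mult)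

lemma phi21_reg_eq:
  assumes "norm z < 1" "qpoch_inf q c \<noteq> 0"
  shows "phi21_reg q a b c z = qpoch_inf q c * phi21 q a b c z"
  unfolding phi21_reg_def phi21_def phi21_reg_term_eq[OF assms(2)]
  by (intro suminf_mult summable_norm_cancel[OF summable_norm_phi21_term] assms)

theorem phi21_Heine_second:
  assumes z: "norm z < 1" and t: "norm (c / b) < 1" and "b \<noteq> 0" "c \<noteq> 0"
    and c: "qpoch_inf q c \<noteq> 0" and bz: "qpoch_inf q (b * z) \<noteq> 0"
  shows "phi21 q a b c z =
    qpoch_inf q (c / b) * qpoch_inf q (b * z) / (qpoch_inf q c * qpoch_inf q z)
    * phi21 q (a * b * z / c) b (b * z) (c / b)"
proof -
  have "a * b * z / c * (c / b) = a * z" "b * (c / b) = c"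
    using \<open>b \<noteq> 0\<close> \<open>c \<noteq> 0\<close> by simp_all
  with phi21_reg_Heine_second[OF z t, of "a * b * z / c" a b]
  have "qpoch_inf q z * (qpoch_inf q c * phi21 q a b c z) =
      qpoch_inf q (c / b) * (qpoch_inf q (b * z) * phi21 q (a * b * z / c) b (b * z) (c / b))"
    by (simp add: phi21_reg_eq z t c bz)
  then show ?thesis
    using c qpoch_inf_nonzero[OF z] by (simp add: field_simps)
qed

lemma phi21_term_q: "phi21_term q q a b z n = qpoch_fin q a n / qpoch_fin q b n * z ^ n"
  using qpoch_fin_nonzero[OF qpoch_inf_nonzero[OF norm_q]] by (simp add: phi21_term_def)

lemma bilateral_series_has_sum:
  assumes "q \<noteq> 0" "a \<noteq> 0" "b \<noteq> 0" and z: "norm z < 1" and baz: "norm (b / (a * z)) < 1"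
    and b: "qpoch_inf q b \<noteq> 0" and qa: "qpoch_inf q (q / a) \<noteq> 0"
  shows "((\<lambda>n::int. qpoch q a n / qpoch q b n * z powi n) has_sum
    (- 1 + phi21 q q a b z + phi21 q q (q / b) (q / a) (b / (a * z)))) UNIV"
proof -
  define f where "f n = qpoch q a n / qpoch q b n * z powi n" for n :: int
  have nat: "f (int n) = phi21_term q q a b z n" for n
    by (simp only: f_def qpoch_nat phi21_term_q power_int_of_nat)
  have neg: "f (- int n) = phi21_term q q (q / b) (q / a) (b / (a * z)) n" for n
  proof -
    have "f (- int n) =
        qpoch_fin q (q / b) n / qpoch_fin q (q / a) n * ((b / a) ^ n * inverse (z ^ n))"
      by (simp add: f_def qpoch_neg_ratio[OF assms(1-3)] power_int_minus)
    also have "(b / a) ^ n * inverse (z ^ n) = (b / (a * z)) ^ n"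
      by (simp add: power_divide power_mult_distrib divide_inverse power_inverse)
    finally show ?thesis
      by (simp only: phi21_term_q)
  qed
  have "(f has_sum ((\<Sum>n. f (int n)) + (\<Sum>n. f (- int n)) - f 0)) UNIV"
    by (rule has_sum_int_from_halves; unfold nat neg)
      (rule summable_norm_phi21_term[OF z b] summable_norm_phi21_term[OF baz qa])+
  moreover have "f 0 = 1"
    using nat[of 0] by (simp add: phi21_term_q)
  ultimately have
    "(f has_sum (- 1 + phi21 q q a b z + phi21 q q (q / b) (q / a) (b / (a * z)))) UNIV"
    by (simp add: nat neg phi21_def algebra_simps)
  then show ?thesis
    unfolding f_def .
qed

lemma bilateral_series_has_sum_Heine:
  assumes "q \<noteq> 0" "a \<noteq> 0" "b \<noteq> 0" and "norm (b / a) < norm z" and z: "norm z < 1"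
    and b: "qpoch_inf q b \<noteq> 0" and qa: "qpoch_inf q (q / a) \<noteq> 0"
    and az: "qpoch_inf q (a * z) \<noteq> 0" and qaz: "qpoch_inf q (q / (a * z)) \<noteq> 0"
  shows "((\<lambda>n::int. qpoch q a n / qpoch q b n * z powi n) has_sum
    (- 1
     + qpoch_inf q (b / a) * qpoch_inf q (a * z) / (qpoch_inf q b * qpoch_inf q z)
       * phi21 q (a * q * z / b) a (a * z) (b / a)
     + qpoch_inf q (b / a) * qpoch_inf q (q / (a * z))
         / (qpoch_inf q (q / a) * qpoch_inf q (b / (a * z)))
       * phi21 q (q / z) (q / b) (q / (a * z)) (b / a))) UNIV"
proof -
  have "z \<noteq> 0" and ba: "norm (b / a) < 1"
    using assms(4,5) by auto
  then have baz: "norm (b / (a * z)) < 1"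
    using assms(4) by (simp add: norm_divide norm_mult flip: divide_divide_eq_left)
  have nonneg: "phi21 q q a b z =
      qpoch_inf q (b / a) * qpoch_inf q (a * z) / (qpoch_inf q b * qpoch_inf q z)
      * phi21 q (a * q * z / b) a (a * z) (b / a)"
    using phi21_Heine_second[OF z ba assms(2,3) b az, of q] by (simp only: mult.commute[of q a])
  have params: "q / a / (q / b) = b / a" "q / b * (b / (a * z)) = q / (a * z)"
      "q * (q / b) * (b / (a * z)) / (q / a) = q / z" and "q / b \<noteq> 0" "q / a \<noteq> 0"
    using assms(1-3) \<open>z \<noteq> 0\<close> by simp_all
  have neg: "phi21 q q (q / b) (q / a) (b / (a * z)) =
      qpoch_inf q (b / a) * qpoch_inf q (q / (a * z))
        / (qpoch_inf q (q / a) * qpoch_inf q (b / (a * z)))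
      * phi21 q (q / z) (q / b) (q / (a * z)) (b / a)"
    using phi21_Heine_second[OF baz _ \<open>q / b \<noteq> 0\<close> \<open>q / a \<noteq> 0\<close> qa, of q,
        unfolded params, OF ba qaz] .
  show ?thesis
    using bilateral_series_has_sum[OF assms(1-3) z baz b qa] unfolding nonneg neg .
qed

end

theorem theorem2p3:
  fixes q a b z :: complex
  assumes "norm q < 1" and "norm (b / a) < norm z" and "norm z < 1"
    and "q \<noteq> 0" and "a \<noteq> 0" and "b \<noteq> 0"
    and "\<And>k::nat. b * q ^ k \<noteq> 1"
    and "\<And>k::nat. q / a * q ^ k \<noteq> 1"
    and "\<And>k::nat. a * z * q ^ k \<noteq> 1"
    and "\<And>k::nat. q / (a * z) * q ^ k \<noteq> 1"
  shows "(\<lambda>n::int. qpoch q a n / qpoch q b n * z powi n) summable_on UNIV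
    \<and> summable (\<lambda>n::nat. qpoch q (a * q * z / b) (int n) * qpoch q a (int n)
          / (qpoch q q (int n) * qpoch q (a * z) (int n)) * (b / a) ^ n)
    \<and> summable (\<lambda>n::nat. qpoch q (q / z) (int n) * qpoch q (q / b) (int n)
          / (qpoch q q (int n) * qpoch q (q / (a * z)) (int n)) * (b / a) ^ n)
    \<and> (\<Sum>\<^sub>\<infinity>n::int. qpoch q a n / qpoch q b n * z powi n) =
        - 1
        + qpoch_inf q (b / a) * qpoch_inf q (a * z) / (qpoch_inf q b * qpoch_inf q z)
          * (\<Sum>n::nat. qpoch q (a * q * z / b) (int n) * qpoch q a (int n)
              / (qpoch q q (int n) * qpoch q (a * z) (int n)) * (b / a) ^ n)
        + qpoch_inf q (b / a) * qpoch_inf q (q / (a * z))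
            / (qpoch_inf q (q / a) * qpoch_inf q (b / (a * z)))
          * (\<Sum>n::nat. qpoch q (q / z) (int n) * qpoch q (q / b) (int n)
              / (qpoch q q (int n) * qpoch q (q / (a * z)) (int n)) * (b / a) ^ n)"
proof -
  interpret q_base q
    using assms(1) by unfold_locales
  have ba: "norm (b / a) < 1"
    using assms(2,3) by (rule less_trans)
  have nonzero: "qpoch_inf q b \<noteq> 0" "qpoch_inf q (q / a) \<noteq> 0"
      "qpoch_inf q (a * z) \<noteq> 0" "qpoch_inf q (q / (a * z)) \<noteq> 0"
    using assms(7-10) by (auto simp: qpoch_inf_eq_0_iff)
  note bilateral = bilateral_series_has_sum_Heine[OF assms(4-6,2,3) nonzero]
  have "summable (phi21_term q (a * q * z / b) a (a * z) (b / a))"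
    and "summable (phi21_term q (q / z) (q / b) (q / (a * z)) (b / a))"
    by (intro summable_norm_cancel[OF summable_norm_phi21_term] ba nonzero)+
  then show ?thesis
    unfolding qpoch_nat phi21_term_def[symmetric] phi21_def[symmetric]
    by (intro conjI has_sum_imp_summable[OF bilateral] infsumI[OF bilateral])
qed

end
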